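(* Let polynomials $g_1,\dots,g_m \in \mathbb{R}[x]=\mathbb{R}[x_1,\dots,x_n]$, $r>0$, and $U_j>0$ such that $U_j \ge \max\{g_j(x) : x \in \mathcal{B}_r\}$, $j=1,\dots,m$, be given. Let $p\in\mathbb{R}[x]$ satisfy $p(x)>0$ for all $x \in \{x \in \mathcal{B}_r : g_j(x)\ge 0,\ j=1,\dots,m\}$. Then: (i) For each choice $\mathcal{K}=\mathcal{K}_{\mathrm{SONC}}$, $\mathcal{K}=\mathcal{K}_{\mathrm{SDSOS}}$, $\mathcal{K}=\mathcal{K}_{\mathrm{DSOS}}$, or $\mathcal{K}=\mathcal{K}_{\mathrm{SAG}}$, there exist $(2n+1)$-variate polynomials $\alpha_j(y,z,u)\in\mathcal{K}$ for $j=0,1$ (with $y=(y_1,\dots,y_n)$, $z=(z_1,\dots,z_n)$, $u$ a single variable), and univariate polynomials $\rho_j(u)\in\mathcal{K}$, $j=1,\dots,m$, such that $$p(x)=\alpha_0(x+re,\,re-x,\,r^2-\|x\|^2)+\alpha_1(x+re,\,re-x,\,r^2-\|x\|^2)\,(r^2-\|x\|^2)+\sum_{j=1}^m \rho_j(U_j-g_j(x))\,g_j(x).$$ (ii) There exist a $(2n+1)$-variate polynomial $\alpha(y,z,u)\in\mathcal{K}_{\mathrm{SAG}}$ and univariate SAG polynomials $\rho_j(u)$, $j=1,\dots,m$, such that $$p(x)=\alpha(x+re,\,re-x,\,r^2-\|x\|^2)+\sum_{j=1}^m \rho_j(U_j-g_j(x))\,g_j(x).$$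
   Context: $\|\cdot\|$ is the Euclidean norm, $\mathcal{B}_r=\{x\in\mathbb{R}^n:\|x\|\le r\}$, and $e$ is the all-ones vector of appropriate dimension. The following classes of real polynomials are defined for any finite number $s$ of variables $w=(w_1,\dots,w_s)$. SDSOS: $q\in\mathcal{K}_{\mathrm{SDSOS}}$ if $q(w)=\sum_{l=1}^k (a_l w^{\alpha_l}+b_l w^{\beta_l})^2$ for some $k\in\mathbb{N}$, $a_l,b_l\in\mathbb{R}$ and $\alpha_l,\beta_l\in\mathbb{N}^s$. DSOS: $q\in\mathcal{K}_{\mathrm{DSOS}}$ if it has such a representation in which moreover, for each $l$, $a_l=b_l$ or $a_l=-b_l$. SONC: a circuit polynomial is a polynomial of the form $q(w)=\sum_{\alpha\in A}c_\alpha w^\alpha-d\,w^\beta$ where $d\in\mathbb{R}$, $c_\alpha>0$ for all $\alpha\in A$, $A\subseteq(2\mathbb{N})^s$ is the vertex set of a simplex (i.e. a finite nonempty affinely independent set), and $\beta\in\mathbb{N}^s$ lies in the (relative) interior of this simplex. $q\in\mathcal{K}_{\mathrm{SONC}}$ if $q$ is a finite sum of circuit polynomials each of which is non-negative on $\mathbb{R}^s$. SAG: an AM/GM polynomial is a polynomial that is non-negative on the non-negative orthant $\mathbb{R}^s_+$ and has at most one negative coefficient. $q\in\mathcal{K}_{\mathrm{SAG}}$ (a SAG polynomial) if $q$ is a finite sum of AM/GM polynomials. *)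

theory Defs
  imports "HOL-Analysis.Analysis" "HOL-Library.Poly_Mapping"
begin

text \<open>Exponent vectors are finitely supported maps \<open>'v \<Rightarrow>\<^sub>0 nat\<close>, so this type, with the ring
  structure of \<^theory>\<open>HOL-Library.Poly_Mapping\<close>, is the polynomial ring over the reals in
  variables indexed by \<open>'v\<close>; \<open>Poly_Mapping.single \<alpha> c\<close> is \<open>c * w^\<alpha>\<close>.\<close>

type_synonym 'v mpoly = "('v \<Rightarrow>\<^sub>0 nat) \<Rightarrow>\<^sub>0 real"

definition mpeval :: "'v::finite mpoly \<Rightarrow> real ^ 'v \<Rightarrow> real" where
  "mpeval q w = (\<Sum>\<alpha>\<in>Poly_Mapping.keys q.
     Poly_Mapping.lookup q \<alpha> * (\<Prod>i\<in>UNIV. (w $ i) ^ Poly_Mapping.lookup \<alpha> i))"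

definition SDSOS :: "'v::finite mpoly set" where
  "SDSOS = {q. \<exists>(k::nat) a b \<alpha> \<beta>.
     q = (\<Sum>l<k. (Poly_Mapping.single (\<alpha> l) (a l) + Poly_Mapping.single (\<beta> l) (b l))\<^sup>2)}"

definition DSOS :: "'v::finite mpoly set" where
  "DSOS = {q. \<exists>(k::nat) a b \<alpha> \<beta>.
     (\<forall>l<k. a l = b l \<or> a l = - b l) \<and>
     q = (\<Sum>l<k. (Poly_Mapping.single (\<alpha> l) (a l) + Poly_Mapping.single (\<beta> l) (b l))\<^sup>2)}"

definition exponent_point :: "('v::finite \<Rightarrow>\<^sub>0 nat) \<Rightarrow> real ^ 'v" where
  "exponent_point \<alpha> = (\<chi> i. real (Poly_Mapping.lookup \<alpha> i))"

definition circuit_polynomial :: "'v::finite mpoly \<Rightarrow> bool" where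
  "circuit_polynomial q \<longleftrightarrow> (\<exists>A c d \<beta>.
     finite A \<and> A \<noteq> {} \<and>
     (\<forall>\<alpha>\<in>A. \<forall>i. even (Poly_Mapping.lookup \<alpha> i)) \<and>
     \<not> affine_dependent (exponent_point ` A) \<and>
     exponent_point \<beta> \<in> rel_interior (convex hull (exponent_point ` A)) \<and>
     (\<forall>\<alpha>\<in>A. c \<alpha> > 0) \<and>
     q = (\<Sum>\<alpha>\<in>A. Poly_Mapping.single \<alpha> (c \<alpha>)) - Poly_Mapping.single \<beta> d)"

definition SONC :: "'v::finite mpoly set" where
  "SONC = {q. \<exists>(k::nat) f.
     (\<forall>l<k. circuit_polynomial (f l) \<and> (\<forall>w. mpeval (f l) w \<ge> 0)) \<and> q = (\<Sum>l<k. f l)}"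

definition AMGM_polynomial :: "'v::finite mpoly \<Rightarrow> bool" where
  "AMGM_polynomial q \<longleftrightarrow>
     (\<forall>w. (\<forall>i. w $ i \<ge> 0) \<longrightarrow> mpeval q w \<ge> 0) \<and>
     card {\<alpha>. Poly_Mapping.lookup q \<alpha> < 0} \<le> 1"

definition SAG :: "'v::finite mpoly set" where
  "SAG = {q. \<exists>(k::nat) f. (\<forall>l<k. AMGM_polynomial (f l)) \<and> q = (\<Sum>l<k. f l)}"

text \<open>The same class has to be used in different numbers of variables, i.e. at different types,
  so one ranges over names of classes rather than over the sets themselves.\<close>

datatype poly_class = SONC_class | SDSOS_class | DSOS_class | SAG_class

fun members :: "poly_class \<Rightarrow> 'v::finite mpoly set" where
  "members SONC_class = SONC"
| "members SDSOS_class = SDSOS"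
| "members DSOS_class = DSOS"
| "members SAG_class = SAG"

definition join_yzu :: "real ^ 'n \<Rightarrow> real ^ 'n \<Rightarrow> real \<Rightarrow> real ^ ('n + 'n + unit)" where
  "join_yzu y z u = (\<chi> i. case i of Inl a \<Rightarrow> y $ a | Inr (Inl b) \<Rightarrow> z $ b | Inr (Inr _) \<Rightarrow> u)"

text \<open>Univariate polynomials are those with variable index type \<^typ>\<open>unit\<close>.\<close>

definition single_var :: "real \<Rightarrow> real ^ unit" where
  "single_var u = (\<chi> i. u)"

definition ones :: "real ^ 'n" where
  "ones = (\<chi> i. 1)"

end

theory Submission
  imports Defs
begin

text \<open>
  Two reductions lead to a theorem of Polya.

  The constraints are removed first. With \<open>\<rho>\<^sub>j(u) = (u / U\<^sub>j)\<^sup>2\<^sup>N\<close> the \<open>j\<close>-th term of the sum is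
  \<open>g\<^sub>j (1 - g\<^sub>j / U\<^sub>j)\<^sup>2\<^sup>N\<close>. On the ball, where \<open>g\<^sub>j \<le> U\<^sub>j\<close>, this is at most \<open>U\<^sub>j / (2 N)\<close> if
  \<open>g\<^sub>j \<ge> 0\<close>, while by Bernoulli's inequality it tends to \<open>-\<infinity>\<close> with \<open>N\<close> if \<open>g\<^sub>j < 0\<close>. By compactness,
  subtracting these terms from \<open>p\<close> leaves, for one large \<open>N\<close>, a polynomial \<open>q\<close> that is positive on
  the whole ball (lemma \<open>absorb_constraints\<close>).

  It remains to represent \<open>q\<close>. The \<open>2 n + 1\<close> functions \<open>(r + x\<^sub>i)\<^sup>2\<close>, \<open>(r - x\<^sub>i)\<^sup>2\<close> and
  \<open>2 (r\<^sup>2 - \<parallel>x\<parallel>\<^sup>2)\<close> add up to the constant \<open>L = 2 (n + 1) r\<^sup>2\<close>, so that after division by \<open>L\<close> they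
  map \<open>\<real>\<^sup>n\<close> into the hyperplane where the coordinates sum to 1, and the ball is exactly the preimage
  of the standard simplex. Moreover \<open>x\<^sub>i\<close> is a linear function of the first two. Hence \<open>q\<close> is the
  pullback of a polynomial \<open>Q\<close> in \<open>2 n + 1\<close> variables, and adding to \<open>Q\<close> a large multiple of the
  sum of squares of the equations of the image, which does not affect the pullback, makes
  \<open>Q\<close> positive on the simplex. Polya's theorem (\<open>polya\<close>) then provides a polynomial with non-negative
  coefficients which agrees with \<open>Q\<close> on the hyperplane. Substituting back, \<open>q\<close> becomes a polynomial
  with non-negative coefficients in \<open>y = x + r e\<close>, \<open>z = r e - x\<close> and \<open>u = r\<^sup>2 - \<parallel>x\<parallel>\<^sup>2\<close>, in which \<open>y\<close>
  and \<open>z\<close> occur only in even powers (\<open>positive_on_ball_representation\<close>).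

  This single representation serves all the claims. A polynomial with non-negative coefficients is
  an AM/GM polynomial, which gives the second part. For the first part, the monomials are separated by
  the parity of the exponent of \<open>u\<close>, and one factor \<open>u\<close> is taken out of those where it is odd. All
  exponents that remain are even, and a positive multiple of an even monomial lies in each of the
  four classes; so do the \<open>\<rho>\<^sub>j\<close>.
\<close>

section \<open>Polynomials and polynomial functions\<close>

definition monom_val :: "real ^ 'v::finite \<Rightarrow> ('v \<Rightarrow>\<^sub>0 nat) \<Rightarrow> real" where
  "monom_val w \<alpha> = (\<Prod>i\<in>UNIV. (w $ i) ^ Poly_Mapping.lookup \<alpha> i)"

lemma monom_val_add: "monom_val w (\<alpha> + \<beta>) = monom_val w \<alpha> * monom_val w \<beta>"
  by (simp add: monom_val_def lookup_add power_add prod.distrib)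

lemma monom_val_variable: "monom_val w (Poly_Mapping.single i 1) = w $ i"
proof -
  have "monom_val w (Poly_Mapping.single i 1) = (\<Prod>j\<in>UNIV. if j = i then w $ i else 1)"
    unfolding monom_val_def by (intro prod.cong) (auto simp: lookup_single when_def)
  then show ?thesis by simp
qed

lemma mpeval_altdef:
  "mpeval q w = (\<Sum>\<alpha>\<in>Poly_Mapping.keys q. Poly_Mapping.lookup q \<alpha> * monom_val w \<alpha>)"
  by (simp add: mpeval_def monom_val_def)

lemma mpeval_add: "mpeval (p + q) w = mpeval p w + mpeval q w"
  unfolding mpeval_altdef
  by (rule setsum_keys_plus_distrib) (simp_all add: distrib_right)

lemma mpeval_zero [simp]: "mpeval 0 w = 0"
  by (simp add: mpeval_altdef)

lemma mpeval_sum: "mpeval (\<Sum>s\<in>S. f s) w = (\<Sum>s\<in>S. mpeval (f s) w)"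
  by (induction S rule: infinite_finite_induct) (simp_all add: mpeval_add)

lemma mpeval_single: "mpeval (Poly_Mapping.single \<alpha> c) w = c * monom_val w \<alpha>"
  by (cases "c = 0") (simp_all add: mpeval_altdef)

lemma mpoly_eq_sum_singles:
  "(q :: 'v mpoly) = (\<Sum>\<alpha>\<in>Poly_Mapping.keys q. Poly_Mapping.single \<alpha> (Poly_Mapping.lookup q \<alpha>))"
  by (rule poly_mapping_eqI)
    (auto simp: lookup_sum lookup_single when_def sum.delta[OF finite_keys] in_keys_iff)

lemma mpeval_mult: "mpeval (p * q) w = mpeval p w * mpeval q w"
proof -
  let ?s = "\<lambda>q \<alpha>. Poly_Mapping.single \<alpha> (Poly_Mapping.lookup q \<alpha>)"
  have "p * q = (\<Sum>\<alpha>\<in>Poly_Mapping.keys p. \<Sum>\<beta>\<in>Poly_Mapping.keys q. ?s p \<alpha> * ?s q \<beta>)"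
    by (subst mpoly_eq_sum_singles[of p], subst mpoly_eq_sum_singles[of q])
      (simp add: sum_product)
  then show ?thesis
    by (simp add: mpeval_sum mult_single mpeval_single monom_val_add mpeval_altdef[of p]
        mpeval_altdef[of q] sum_product mult_ac)
qed

lemma real_polynomial_function_mpeval: "real_polynomial_function (mpeval q)"
proof -
  have "real_polynomial_function (\<lambda>w. w $ i)" for i :: 'a
    by (intro real_polynomial_function.intros bounded_linear_vec_nth)
  then show ?thesis
    unfolding mpeval_def
    by (intro real_polynomial_function_sum real_polynomial_function.intros(2,4)
        real_polynomial_function_prod real_polynomial_function_power) auto
qed

lemma real_polynomial_function_imp_mpeval:
  fixes f :: "real ^ 'v::finite \<Rightarrow> real"
  assumes "real_polynomial_function f"
  shows "\<exists>q. f = mpeval q"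
  using assms
proof induction
  case (linear f)
  have "f w = mpeval (\<Sum>i\<in>UNIV. Poly_Mapping.single (Poly_Mapping.single i 1) (f (axis i 1))) w" for w
  proof -
    have "f w = f (\<Sum>i\<in>UNIV. w $ i *\<^sub>R axis i 1)"
      by (simp add: basis_expansion flip: scalar_mult_eq_scaleR)
    also have "\<dots> = (\<Sum>i\<in>UNIV. w $ i * f (axis i 1))"
      using bounded_linear.linear[OF linear] by (simp add: linear_sum linear_scale)
    finally show ?thesis
      by (simp add: mpeval_sum mpeval_single monom_val_variable[unfolded One_nat_def] mult.commute)
  qed
  then show ?case by blast
next
  case (const c)
  have "(\<lambda>w. c) = mpeval (Poly_Mapping.single (0 :: 'v \<Rightarrow>\<^sub>0 nat) c)"
    by (simp add: fun_eq_iff mpeval_single monom_val_def)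
  then show ?case by blast
next
  case (add f g)
  then show ?case using mpeval_add by (metis (no_types, lifting) ext)
next
  case (mult f g)
  then show ?case using mpeval_mult by (metis (no_types, lifting) ext)
qed

section \<open>Degree elevation and Polya's theorem\<close>

definition total_degree :: "('v::finite \<Rightarrow>\<^sub>0 nat) \<Rightarrow> nat" where
  "total_degree \<alpha> = (\<Sum>i\<in>UNIV. Poly_Mapping.lookup \<alpha> i)"

lemma total_degree_add: "total_degree (\<alpha> + \<beta>) = total_degree \<alpha> + total_degree \<beta>"
  by (simp add: total_degree_def lookup_add sum.distrib)

lemma total_degree_variable: "total_degree (Poly_Mapping.single i 1) = 1"
  by (simp add: total_degree_def lookup_single when_def)

lemma finite_total_degree: "finite {\<beta> :: 'v::finite \<Rightarrow>\<^sub>0 nat. total_degree \<beta> = d}"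
proof (rule finite_imageD)
  have "Poly_Mapping.lookup ` {\<beta> :: 'v \<Rightarrow>\<^sub>0 nat. total_degree \<beta> = d} \<subseteq> Pi\<^sub>E UNIV (\<lambda>_. {..d})"
    by (auto simp: total_degree_def PiE_def extensional_def intro!: member_le_sum)
  then show "finite (Poly_Mapping.lookup ` {\<beta> :: 'v \<Rightarrow>\<^sub>0 nat. total_degree \<beta> = d})"
    by (rule finite_subset) (intro finite_PiE, auto)
  show "inj_on Poly_Mapping.lookup {\<beta> :: 'v \<Rightarrow>\<^sub>0 nat. total_degree \<beta> = d}"
    by (intro inj_onI poly_mapping_eqI) simp
qed

text \<open>The number \<open>a! / b!\<close> times the binomial coefficient of \<open>b\<close> over \<open>a\<close>. It obeys two descriptions:
  as the reciprocal of \<open>(b - a)!\<close> it satisfies the recursion behind the multinomial theorem, and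
  as a falling factorial divided by \<open>b!\<close> it has a visible limit when \<open>b\<close> grows.\<close>

definition recip_fact :: "nat \<Rightarrow> nat \<Rightarrow> real" where
  "recip_fact b a = (if a \<le> b then 1 / fact (b - a) else 0)"

lemma recip_fact_pred:
  assumes "b > 0"
  shows "recip_fact (b - 1) a = (real b - real a) * recip_fact b a"
proof -
  consider "a < b" | "a = b" | "a > b" by linarith
  then show ?thesis
  proof cases
    case 1
    then obtain k where "b = Suc (a + k)" using less_iff_Suc_add by auto
    moreover have "fact k + fact k * real k > 0"
      by (intro add_pos_nonneg) auto
    ultimately show ?thesis by (simp add: recip_fact_def Suc_diff_le field_simps)
  qed (use assms in \<open>auto simp: recip_fact_def\<close>)
qed

lemma recip_fact_zero: "(real 0 - real a) * recip_fact 0 a = 0"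
  by (simp add: recip_fact_def)

lemma recip_fact_eq_falling_factorial:
  "recip_fact b a = (\<Prod>k<a. real b - real k) / fact b"
proof (induction a)
  case (Suc a)
  have "recip_fact b (Suc a) = (real b - real a) * recip_fact b a"
  proof (cases "b = 0")
    case False
    then have "recip_fact b (Suc a) = recip_fact (b - 1) a"
      by (auto simp: recip_fact_def)
    with False show ?thesis using recip_fact_pred[of b a] by simp
  qed (simp add: recip_fact_def)
  then show ?case by (simp add: Suc.IH)
qed (simp add: recip_fact_def)

text \<open>The reciprocal of \<open>(\<beta> - \<alpha>)!\<close> in multi-index notation, and 0 unless \<open>\<alpha> \<le> \<beta>\<close> componentwise.\<close>

definition elevation_coeff :: "('v::finite \<Rightarrow>\<^sub>0 nat) \<Rightarrow> ('v \<Rightarrow>\<^sub>0 nat) \<Rightarrow> real" where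
  "elevation_coeff \<beta> \<alpha> = (\<Prod>i\<in>UNIV. recip_fact (Poly_Mapping.lookup \<beta> i) (Poly_Mapping.lookup \<alpha> i))"

lemma elevation_coeff_self: "elevation_coeff \<alpha> \<alpha> = 1"
  by (simp add: elevation_coeff_def recip_fact_def)

text \<open>Two different exponent vectors of equal degree are incomparable, so some factor of the product
  vanishes. This is the start of the induction for degree elevation.\<close>

lemma elevation_coeff_same_degree:
  assumes "total_degree \<beta> = total_degree \<alpha>" "\<beta> \<noteq> \<alpha>"
  shows "elevation_coeff \<beta> \<alpha> = 0"
proof -
  have "\<exists>i. Poly_Mapping.lookup \<beta> i < Poly_Mapping.lookup \<alpha> i"
  proof (rule ccontr)
    assume "\<nexists>i. Poly_Mapping.lookup \<beta> i < Poly_Mapping.lookup \<alpha> i"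
    then have le: "Poly_Mapping.lookup \<alpha> i \<le> Poly_Mapping.lookup \<beta> i" for i
      by (simp add: not_less)
    obtain i where ne: "Poly_Mapping.lookup \<beta> i \<noteq> Poly_Mapping.lookup \<alpha> i"
      using assms(2) by (auto simp: poly_mapping_eq_iff fun_eq_iff)
    have "Poly_Mapping.lookup \<alpha> i < Poly_Mapping.lookup \<beta> i"
      using le[of i] ne by simp
    then have "total_degree \<alpha> < total_degree \<beta>"
      unfolding total_degree_def using le by (intro sum_strict_mono_ex1) auto
    with assms(1) show False by simp
  qed
  then obtain i where "Poly_Mapping.lookup \<beta> i < Poly_Mapping.lookup \<alpha> i" by blast
  then have "recip_fact (Poly_Mapping.lookup \<beta> i) (Poly_Mapping.lookup \<alpha> i) = 0"
    by (simp add: recip_fact_def)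
  then show ?thesis
    unfolding elevation_coeff_def by (intro prod_zero) auto
qed

text \<open>Summed over \<open>i\<close>, the factors on the right add up to the difference of the degrees. This turns
  multiplication by the sum of the variables into multiplication by a number.\<close>

lemma elevation_coeff_step:
  "(if Poly_Mapping.lookup \<beta> i \<noteq> 0 then elevation_coeff (\<beta> - Poly_Mapping.single i 1) \<alpha> else 0)
    = (real (Poly_Mapping.lookup \<beta> i) - real (Poly_Mapping.lookup \<alpha> i)) * elevation_coeff \<beta> \<alpha>"
proof -
  let ?b = "Poly_Mapping.lookup \<beta>" and ?a = "Poly_Mapping.lookup \<alpha>"
  have split: "elevation_coeff \<gamma> \<alpha> = recip_fact (Poly_Mapping.lookup \<gamma> i) (?a i) *
      (\<Prod>j\<in>UNIV - {i}. recip_fact (Poly_Mapping.lookup \<gamma> j) (?a j))" for \<gamma>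
    unfolding elevation_coeff_def by (rule prod.remove) auto
  have rest: "(\<Prod>j\<in>UNIV - {i}. recip_fact (Poly_Mapping.lookup (\<beta> - Poly_Mapping.single i 1) j) (?a j))
      = (\<Prod>j\<in>UNIV - {i}. recip_fact (?b j) (?a j))"
    by (intro prod.cong) (auto simp: lookup_minus lookup_single when_def)
  show ?thesis
  proof (cases "?b i = 0")
    case True
    then show ?thesis
      using recip_fact_zero[of "?a i"] by (auto simp: split[of \<beta>] simp del: prod_zero_iff)
  next
    case False
    then have "recip_fact (?b i - 1) (?a i) = (real (?b i) - real (?a i)) * recip_fact (?b i) (?a i)"
      by (intro recip_fact_pred) simp
    with False show ?thesis
      by (simp only: split rest) (simp add: lookup_minus)
  qed
qed

lemma sum_shift_exponent:
  fixes F :: "('v::finite \<Rightarrow>\<^sub>0 nat) \<Rightarrow> 'v \<Rightarrow> real"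
  shows "(\<Sum>\<beta> | total_degree \<beta> = d. \<Sum>i\<in>UNIV. F (\<beta> + Poly_Mapping.single i 1) i) =
    (\<Sum>\<beta> | total_degree \<beta> = Suc d. \<Sum>i\<in>UNIV. if Poly_Mapping.lookup \<beta> i \<noteq> 0 then F \<beta> i else 0)"
proof -
  let ?e = "\<lambda>i. Poly_Mapping.single i (1::nat)"
  let ?S = "{\<beta> :: 'v \<Rightarrow>\<^sub>0 nat. total_degree \<beta> = Suc d}"
  have cancel: "\<beta> - ?e i + ?e i = \<beta>" if "Poly_Mapping.lookup \<beta> i \<noteq> 0" for \<beta> and i :: 'v
    using that by (intro poly_mapping_eqI) (auto simp: lookup_add lookup_minus lookup_single when_def)
  have degree_pred: "total_degree (\<beta> - ?e i) = d"
    if "total_degree \<beta> = Suc d" "Poly_Mapping.lookup \<beta> i \<noteq> 0" for \<beta> and i :: 'v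
  proof -
    have "total_degree (\<beta> - ?e i + ?e i) = Suc d"
      using that cancel by simp
    then show ?thesis
      unfolding total_degree_add total_degree_variable by simp
  qed
  have "(\<Sum>\<beta> | total_degree \<beta> = d. \<Sum>i\<in>UNIV. F (\<beta> + ?e i) i) =
      (\<Sum>(\<beta>, i)\<in>{\<beta>. total_degree \<beta> = d} \<times> UNIV. F (\<beta> + ?e i) i)"
    by (rule sum.cartesian_product)
  also have "\<dots> = (\<Sum>(\<beta>, i)\<in>{x \<in> ?S \<times> UNIV. Poly_Mapping.lookup (fst x) (snd x) \<noteq> 0}. F \<beta> i)"
    by (rule sum.reindex_bij_witness[where i = "\<lambda>(\<beta>, i). (\<beta> - ?e i, i)"
        and j = "\<lambda>(\<beta>, i). (\<beta> + ?e i, i)"])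
      (auto simp: cancel[unfolded One_nat_def] degree_pred[unfolded One_nat_def] lookup_add
        total_degree_add total_degree_variable[unfolded One_nat_def])
  also have "\<dots> = (\<Sum>(\<beta>, i)\<in>?S \<times> UNIV. if Poly_Mapping.lookup \<beta> i \<noteq> 0 then F \<beta> i else 0)"
    by (intro sum.mono_neutral_cong_left) (auto simp: finite_total_degree split: if_splits)
  also have "\<dots> = (\<Sum>\<beta>\<in>?S. \<Sum>i\<in>UNIV. if Poly_Mapping.lookup \<beta> i \<noteq> 0 then F \<beta> i else 0)"
    by (rule sum.cartesian_product[symmetric])
  finally show ?thesis .
qed

text \<open>The multinomial theorem, shifted by \<open>\<alpha>\<close>. It is proved by multiplying repeatedly with the sum of
  the variables, each coefficient of the product collecting contributions from the exponents
  below it.\<close>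

lemma monomial_degree_elevation:
  "monom_val w \<alpha> * (\<Sum>i\<in>UNIV. w $ i) ^ n / fact n =
    (\<Sum>\<beta> | total_degree \<beta> = total_degree \<alpha> + n. elevation_coeff \<beta> \<alpha> * monom_val w \<beta>)"
proof (induction n)
  case 0
  have "(\<Sum>\<beta> | total_degree \<beta> = total_degree \<alpha>. elevation_coeff \<beta> \<alpha> * monom_val w \<beta>) =
      (\<Sum>\<beta>\<in>{\<alpha>}. elevation_coeff \<beta> \<alpha> * monom_val w \<beta>)"
    by (intro sum.mono_neutral_right) (auto simp: finite_total_degree elevation_coeff_same_degree)
  then show ?case by (simp add: elevation_coeff_self)
next
  case (Suc n)
  let ?d = "total_degree \<alpha> + n" and ?e = "\<lambda>i. Poly_Mapping.single i (1::nat)"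
  have "monom_val w \<alpha> * (\<Sum>i\<in>UNIV. w $ i) ^ n / fact n * (\<Sum>i\<in>UNIV. w $ i) =
      (\<Sum>\<beta> | total_degree \<beta> = ?d. \<Sum>i\<in>UNIV.
        elevation_coeff (\<beta> + ?e i - ?e i) \<alpha> * monom_val w (\<beta> + ?e i))"
    unfolding Suc.IH sum_product monom_val_add monom_val_variable add_diff_cancel_right'
    by (simp add: mult_ac)
  also have "\<dots> = (\<Sum>\<beta> | total_degree \<beta> = Suc ?d. \<Sum>i\<in>UNIV.
      if Poly_Mapping.lookup \<beta> i \<noteq> 0 then elevation_coeff (\<beta> - ?e i) \<alpha> * monom_val w \<beta> else 0)"
    by (rule sum_shift_exponent)
  also have "\<dots> = (\<Sum>\<beta> | total_degree \<beta> = Suc ?d. \<Sum>i\<in>UNIV.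
      (real (Poly_Mapping.lookup \<beta> i) - real (Poly_Mapping.lookup \<alpha> i)) *
        (elevation_coeff \<beta> \<alpha> * monom_val w \<beta>))"
  proof (intro sum.cong refl)
    fix \<beta> i
    show "(if Poly_Mapping.lookup \<beta> i \<noteq> 0
          then elevation_coeff (\<beta> - ?e i) \<alpha> * monom_val w \<beta> else 0) =
        (real (Poly_Mapping.lookup \<beta> i) - real (Poly_Mapping.lookup \<alpha> i)) *
          (elevation_coeff \<beta> \<alpha> * monom_val w \<beta>)"
      using elevation_coeff_step[of \<beta> i \<alpha>]
      by (cases "Poly_Mapping.lookup \<beta> i = 0") (auto simp flip: mult.assoc)
  qed
  also have "\<dots> = (\<Sum>\<beta> | total_degree \<beta> = Suc ?d.
      (real (total_degree \<beta>) - real (total_degree \<alpha>)) * (elevation_coeff \<beta> \<alpha> * monom_val w \<beta>))"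
    unfolding sum_distrib_right[symmetric] sum_subtractf total_degree_def of_nat_sum ..
  also have "\<dots> = real (Suc n) *
      (\<Sum>\<beta> | total_degree \<beta> = total_degree \<alpha> + Suc n. elevation_coeff \<beta> \<alpha> * monom_val w \<beta>)"
    by (simp add: sum_distrib_left)
  finally show ?case 
    by (simp add: divide_simps del: of_nat_Suc) (simp add: mult_ac)
qed

text \<open>The coefficients arising in degree elevation, normalised by the multinomial coefficient,
  behave like the value of the monomial at the point with coordinates \<open>\<beta>\<^sub>i / M\<close>: they are products of factors
  \<open>(\<beta>\<^sub>i - k) / M\<close> divided by products of factors \<open>1 - k / M\<close>, with a fixed number of bounded \<open>k\<close>, so
  that all \<open>k / M\<close> disappear in the limit.\<close>

lemma elevation_coeff_limit:
  fixes b :: "nat \<Rightarrow> ('v::finite \<Rightarrow>\<^sub>0 nat)" and x :: "real ^ 'v"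
  assumes "filterlim M at_top sequentially"
    and "\<And>n. M n \<ge> total_degree \<alpha>"
    and "\<And>i. (\<lambda>n. real (Poly_Mapping.lookup (b n) i) / real (M n)) \<longlonglongrightarrow> x $ i"
  shows "(\<lambda>n. fact (M n - total_degree \<alpha>) / fact (M n) *
      (elevation_coeff (b n) \<alpha> * (\<Prod>i\<in>UNIV. fact (Poly_Mapping.lookup (b n) i))))
    \<longlonglongrightarrow> monom_val x \<alpha>"
proof -
  let ?a = "Poly_Mapping.lookup \<alpha>" and ?b = "\<lambda>n. Poly_Mapping.lookup (b n)"
  let ?A = "total_degree \<alpha>"
  have M: "(\<lambda>n. real k / real (M n)) \<longlonglongrightarrow> 0" for k
    using assms(1) by (intro tendsto_divide_0[OF tendsto_const])
      (auto intro: filterlim_at_top_imp_at_infinity filterlim_compose[OF filterlim_real_sequentially])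
  have "(\<lambda>n. (\<Prod>i\<in>UNIV. \<Prod>k<?a i. real (?b n i) / real (M n) - real k / real (M n)) /
      (\<Prod>k<?A. 1 - real k / real (M n))) \<longlonglongrightarrow>
    (\<Prod>i\<in>UNIV. \<Prod>k<?a i. x $ i - 0) / (\<Prod>k<?A. 1 - 0)"
    by (intro tendsto_divide tendsto_prod tendsto_diff tendsto_const M assms(3)) simp
  moreover have "\<forall>\<^sub>F n in sequentially. M n > 0"
    using assms(1) by (rule eventually_compose_filterlim[OF eventually_gt_at_top])
  then have "\<forall>\<^sub>F n in sequentially.
      (\<Prod>i\<in>UNIV. \<Prod>k<?a i. real (?b n i) / real (M n) - real k / real (M n)) /
        (\<Prod>k<?A. 1 - real k / real (M n)) =
      fact (M n - ?A) / fact (M n) *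
        (elevation_coeff (b n) \<alpha> * (\<Prod>i\<in>UNIV. fact (?b n i)))"
  proof eventually_elim
    case (elim n)
    have "(\<Prod>i\<in>UNIV. \<Prod>k<?a i. real (?b n i) / real (M n) - real k / real (M n)) =
        (\<Prod>i\<in>UNIV. (recip_fact (?b n i) (?a i) * fact (?b n i)) / real (M n) ^ ?a i)"
      by (simp add: recip_fact_eq_falling_factorial prod_dividef flip: diff_divide_distrib)
    also have "\<dots> = elevation_coeff (b n) \<alpha> * (\<Prod>i\<in>UNIV. fact (?b n i)) / real (M n) ^ ?A"
      by (simp add: prod_dividef prod.distrib elevation_coeff_def total_degree_def power_sum)
    finally have num: "(\<Prod>i\<in>UNIV. \<Prod>k<?a i. real (?b n i) / real (M n) - real k / real (M n)) =
        elevation_coeff (b n) \<alpha> * (\<Prod>i\<in>UNIV. fact (?b n i)) / real (M n) ^ ?A" .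
    have "(\<Prod>k<?A. 1 - real k / real (M n)) = (\<Prod>k<?A. (real (M n) - real k) / real (M n))"
      using elim by (intro prod.cong) (auto simp: diff_divide_distrib)
    also have "\<dots> = recip_fact (M n) ?A * fact (M n) / real (M n) ^ ?A"
      by (simp add: recip_fact_eq_falling_factorial prod_dividef)
    also have "recip_fact (M n) ?A = 1 / fact (M n - ?A)"
      using assms(2)[of n] by (simp add: recip_fact_def)
    finally show ?case
      unfolding num using elim by simp
  qed
  ultimately show ?thesis
    by (simp add: filterlim_cong[OF refl refl] monom_val_def)
qed

text \<open>The coefficient of \<open>w\<^sup>\<beta>\<close> when \<open>q\<close> has degree at most \<open>M\<close> and each of its monomials is raised to degree
  \<open>M\<close> by means of \<open>\<Sum>\<^sub>i w\<^sub>i = 1\<close>.\<close>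

definition polya_coeff :: "'v::finite mpoly \<Rightarrow> nat \<Rightarrow> ('v \<Rightarrow>\<^sub>0 nat) \<Rightarrow> real" where
  "polya_coeff q M \<beta> = (\<Sum>\<alpha>\<in>Poly_Mapping.keys q.
     Poly_Mapping.lookup q \<alpha> * fact (M - total_degree \<alpha>) * elevation_coeff \<beta> \<alpha>)"

lemma mpeval_eq_polya_coeffs:
  assumes "\<And>\<alpha>. \<alpha> \<in> Poly_Mapping.keys q \<Longrightarrow> total_degree \<alpha> \<le> M"
    and "(\<Sum>i\<in>UNIV. w $ i) = 1"
  shows "mpeval q w = (\<Sum>\<beta> | total_degree \<beta> = M. polya_coeff q M \<beta> * monom_val w \<beta>)"
proof -
  have "mpeval q w = (\<Sum>\<alpha>\<in>Poly_Mapping.keys q. Poly_Mapping.lookup q \<alpha> * fact (M - total_degree \<alpha>) *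
      (\<Sum>\<beta> | total_degree \<beta> = M. elevation_coeff \<beta> \<alpha> * monom_val w \<beta>))"
    unfolding mpeval_altdef
  proof (intro sum.cong refl)
    fix \<alpha> assume "\<alpha> \<in> Poly_Mapping.keys q"
    then have "total_degree \<alpha> + (M - total_degree \<alpha>) = M"
      using assms(1) by simp
    with monomial_degree_elevation[of w \<alpha> "M - total_degree \<alpha>"]
    show "Poly_Mapping.lookup q \<alpha> * monom_val w \<alpha> =
        Poly_Mapping.lookup q \<alpha> * fact (M - total_degree \<alpha>) *
        (\<Sum>\<beta> | total_degree \<beta> = M. elevation_coeff \<beta> \<alpha> * monom_val w \<beta>)"
      by (simp add: assms(2) field_simps)
  qed
  also have "\<dots> = (\<Sum>\<beta> | total_degree \<beta> = M. polya_coeff q M \<beta> * monom_val w \<beta>)"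
    unfolding polya_coeff_def sum_distrib_left sum_distrib_right
    by (subst sum.swap) (simp add: mult_ac)
  finally show ?thesis .
qed

definition standard_simplex :: "(real ^ 'v::finite) set" where
  "standard_simplex = {w. (\<forall>i. w $ i \<ge> 0) \<and> (\<Sum>i\<in>UNIV. w $ i) = 1}"

lemma compact_standard_simplex: "compact standard_simplex"
  unfolding compact_eq_bounded_closed
proof (rule conjI)
  show "bounded (standard_simplex :: (real ^ 'v) set)"
    unfolding bounded_iff
  proof (intro exI ballI)
    fix w :: "real ^ 'v" assume "w \<in> standard_simplex"
    then have "(\<Sum>i\<in>UNIV. \<bar>w $ i\<bar>) = 1"
      by (simp add: standard_simplex_def)
    with norm_le_l1_cart[of w] show "norm w \<le> 1" by simp
  qed
  show "closed (standard_simplex :: (real ^ 'v) set)"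
    unfolding standard_simplex_def
    by (intro closed_Collect_conj closed_Collect_all closed_Collect_le closed_Collect_eq
        continuous_intros)
qed

text \<open>If negative coefficients occurred in arbitrarily high degree, the points \<open>\<beta> / M\<close> of the simplex
  would accumulate at some \<open>x\<close>. Up to a positive factor the coefficients converge to the value of
  \<open>q\<close> at \<open>x\<close>, which would therefore not be positive.\<close>

lemma polya_coeff_nonneg:
  fixes q :: "'v::finite mpoly"
  assumes pos: "\<And>w. w \<in> standard_simplex \<Longrightarrow> mpeval q w > 0"
    and deg: "\<And>\<alpha>. \<alpha> \<in> Poly_Mapping.keys q \<Longrightarrow> total_degree \<alpha> \<le> d"
  shows "\<exists>M\<ge>d. \<forall>\<beta>. total_degree \<beta> = M \<longrightarrow> polya_coeff q M \<beta> \<ge> 0"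
proof (rule ccontr)
  assume "\<not> ?thesis"
  then have "\<forall>n. \<exists>\<beta>. total_degree \<beta> = Suc (d + n) \<and> polya_coeff q (Suc (d + n)) \<beta> < 0"
    by (metis le_SucI le_add1 not_less)
  then obtain b where b: "\<And>n. total_degree (b n) = Suc (d + n)"
    "\<And>n. polya_coeff q (Suc (d + n)) (b n) < 0"
    by metis
  define X where "X n = (\<chi> i. real (Poly_Mapping.lookup (b n) i) / real (Suc (d + n)))" for n
  have sum_b: "(\<Sum>i\<in>UNIV. real (Poly_Mapping.lookup (b n) i)) = real (Suc (d + n))" for n
    using b(1)[of n] by (simp only: total_degree_def flip: of_nat_sum)
  have X: "X n \<in> standard_simplex" for n
    using sum_b[of n] by (auto simp: X_def standard_simplex_def simp del: of_nat_Suc simp flip: sum_divide_distrib)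
  obtain x s where x: "x \<in> standard_simplex" and s: "strict_mono s" "(X \<circ> s) \<longlonglongrightarrow> x"
    using X compact_standard_simplex[unfolded compact_def] by metis
  define M where "M n = Suc (d + s n)" for n
  have M_lim: "filterlim M at_top sequentially"
    unfolding M_def
    by (rule filterlim_at_top_mono[OF filterlim_subseq[OF s(1)]]) auto
  have b_lim: "(\<lambda>n. real (Poly_Mapping.lookup (b (s n)) i) / real (M n)) \<longlonglongrightarrow> x $ i" for i
    using tendsto_vec_nth[OF s(2), of i] by (simp add: X_def M_def o_def)
  let ?F = "\<lambda>n. \<Prod>i\<in>UNIV. fact (Poly_Mapping.lookup (b (s n)) i)"
  have "(\<lambda>n. \<Sum>\<alpha>\<in>Poly_Mapping.keys q. Poly_Mapping.lookup q \<alpha> *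
      (fact (M n - total_degree \<alpha>) / fact (M n) * (elevation_coeff (b (s n)) \<alpha> * ?F n)))
      \<longlonglongrightarrow> mpeval q x"
    unfolding mpeval_altdef
    by (intro tendsto_sum tendsto_mult tendsto_const elevation_coeff_limit M_lim b_lim)
      (use deg in \<open>auto simp: M_def intro!: le_SucI trans_le_add1\<close>)
  moreover have "(\<Sum>\<alpha>\<in>Poly_Mapping.keys q. Poly_Mapping.lookup q \<alpha> *
      (fact (M n - total_degree \<alpha>) / fact (M n) * (elevation_coeff (b (s n)) \<alpha> * ?F n))) =
      polya_coeff q (M n) (b (s n)) * (?F n / fact (M n))" for n
    unfolding polya_coeff_def sum_distrib_right by (intro sum.cong) simp_all
  moreover have "polya_coeff q (M n) (b (s n)) * (?F n / fact (M n)) \<le> 0" for n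
    using b(2)[of "s n"] by (intro mult_nonpos_nonneg) (auto simp: M_def intro!: divide_nonneg_nonneg prod_nonneg)
  ultimately have "mpeval q x \<le> 0"
    by (intro LIMSEQ_le_const2) auto
  with pos x show False by force
qed

text \<open>Non-negative coefficients together with a restriction on the exponents suffice for membership in
  the four classes, so no other property of the polynomials has to be passed on.\<close>

definition monomial_cone :: "('v::finite \<Rightarrow>\<^sub>0 nat) set \<Rightarrow> 'v mpoly set" where
  "monomial_cone E = {q. \<forall>\<beta>. Poly_Mapping.lookup q \<beta> \<ge> 0 \<and> (Poly_Mapping.lookup q \<beta> \<noteq> 0 \<longrightarrow> \<beta> \<in> E)}"

lemma monomial_cone_single: "c \<ge> 0 \<Longrightarrow> \<beta> \<in> E \<Longrightarrow> Poly_Mapping.single \<beta> c \<in> monomial_cone E"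
  by (auto simp: monomial_cone_def lookup_single when_def)

lemma monomial_cone_sum:
  assumes "\<And>s. s \<in> S \<Longrightarrow> f s \<in> monomial_cone E"
  shows "(\<Sum>s\<in>S. f s) \<in> monomial_cone E"
proof -
  have "(\<Sum>s\<in>S. Poly_Mapping.lookup (f s) \<beta>) \<ge> 0" for \<beta>
    using assms by (intro sum_nonneg) (simp add: monomial_cone_def)
  moreover have "\<beta> \<in> E" if nz: "(\<Sum>s\<in>S. Poly_Mapping.lookup (f s) \<beta>) \<noteq> 0" for \<beta>
  proof -
    obtain s where "s \<in> S" "Poly_Mapping.lookup (f s) \<beta> \<noteq> 0"
      using nz by (rule sum.not_neutral_contains_not_neutral)
    with assms[of s] show ?thesis by (simp add: monomial_cone_def)
  qed
  ultimately show ?thesis by (simp add: monomial_cone_def lookup_sum)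
qed

lemma monomial_cone_mono: "q \<in> monomial_cone E \<Longrightarrow> E \<subseteq> E' \<Longrightarrow> q \<in> monomial_cone E'"
  by (auto simp: monomial_cone_def)

lemma monomial_cone_lookup_nonneg: "q \<in> monomial_cone E \<Longrightarrow> Poly_Mapping.lookup q \<beta> \<ge> 0"
  by (simp add: monomial_cone_def)

lemma monomial_cone_keys: "q \<in> monomial_cone E \<Longrightarrow> \<beta> \<in> Poly_Mapping.keys q \<Longrightarrow> \<beta> \<in> E"
  by (simp add: monomial_cone_def in_keys_iff)

text \<open>Polya's theorem in its inhomogeneous form: instead of multiplying a form by a power of the sum of the
  variables, both polynomials are compared on the hyperplane where this sum is 1.\<close>

theorem polya:
  fixes q :: "'v::finite mpoly"
  assumes "\<And>w. w \<in> standard_simplex \<Longrightarrow> mpeval q w > 0"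
  shows "\<exists>q'\<in>monomial_cone UNIV. (\<forall>w. (\<Sum>i\<in>UNIV. w $ i) = 1 \<longrightarrow> mpeval q w = mpeval q' w)"
proof -
  define d where "d = (\<Sum>\<alpha>\<in>Poly_Mapping.keys q. total_degree \<alpha>)"
  have deg: "total_degree \<alpha> \<le> d" if "\<alpha> \<in> Poly_Mapping.keys q" for \<alpha>
    unfolding d_def using that by (intro member_le_sum) auto
  obtain M where M: "M \<ge> d" "\<And>\<beta>. total_degree \<beta> = M \<Longrightarrow> polya_coeff q M \<beta> \<ge> 0"
    using polya_coeff_nonneg[OF assms deg] by blast
  define q' where "q' = (\<Sum>\<beta> | total_degree \<beta> = M. Poly_Mapping.single \<beta> (polya_coeff q M \<beta>))"
  have "q' \<in> monomial_cone UNIV"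
    unfolding q'_def using M(2) by (intro monomial_cone_sum monomial_cone_single) auto
  moreover have "mpeval q w = mpeval q' w" if "(\<Sum>i\<in>UNIV. w $ i) = 1" for w
    using deg M(1) that
    by (subst mpeval_eq_polya_coeffs[of q M]) (auto simp: q'_def mpeval_sum mpeval_single intro: order.trans)
  ultimately show ?thesis by blast
qed

section \<open>Positivity on compact sets\<close>

lemma compact_positive_bounded_below:
  fixes f :: "'a::topological_space \<Rightarrow> real"
  assumes "compact S" "continuous_on S f" "\<And>x. x \<in> S \<Longrightarrow> f x > 0"
  obtains \<mu> where "\<mu> > 0" "\<And>x. x \<in> S \<Longrightarrow> f x \<ge> \<mu>"
proof (cases "S = {}")
  case True
  then show ?thesis using that[of 1] by simp
next
  case False
  then obtain x where "x \<in> S" "\<forall>y\<in>S. f x \<le> f y"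
    using continuous_attains_inf[OF assms(1) _ assms(2)] by blast
  then show ?thesis using that[of "f x"] assms(3) by auto
qed

text \<open>The maximum of \<open>f\<close> and \<open>h\<close> is positive on \<open>S\<close>, hence at least some \<open>\<eta> > 0\<close>. Where \<open>h \<ge> \<eta>\<close>, a
  large multiple of \<open>h\<close> outweighs the bounded function \<open>f\<close>; elsewhere \<open>f \<ge> \<eta>\<close>. The lemma is used for the
  inequality constraints as well as for the equations of the image of the ball in the simplex.\<close>

lemma compact_penalty:
  fixes f h :: "'a::topological_space \<Rightarrow> real"
  assumes "compact S" "continuous_on S f" "continuous_on S h"
    and nonneg: "\<And>x. x \<in> S \<Longrightarrow> h x \<ge> 0"
    and pos: "\<And>x. x \<in> S \<Longrightarrow> h x = 0 \<Longrightarrow> f x > 0"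
  obtains \<kappa> where "\<kappa> \<ge> 0" "\<And>x. x \<in> S \<Longrightarrow> f x + \<kappa> * h x > 0"
proof -
  have max_pos: "max (f x) (h x) > 0" if "x \<in> S" for x
    using nonneg[OF that] pos[OF that] by (cases "h x = 0") (auto simp: less_max_iff_disj)
  obtain \<eta> where \<eta>: "\<eta> > 0" "\<And>x. x \<in> S \<Longrightarrow> max (f x) (h x) \<ge> \<eta>"
    using compact_positive_bounded_below[OF assms(1) continuous_on_max[OF assms(2,3)] max_pos]
    by blast
  have "bounded (f ` S)"
    using assms(1,2) by (intro compact_imp_bounded compact_continuous_image)
  then obtain B where B: "B > 0" "\<And>x. x \<in> S \<Longrightarrow> \<bar>f x\<bar> \<le> B"
    unfolding bounded_pos by auto
  show ?thesis
  proof (rule that[of "(B + 1) / \<eta>"])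
    show "(B + 1) / \<eta> \<ge> 0" using B(1) \<eta>(1) by simp
    fix x assume x: "x \<in> S"
    show "f x + (B + 1) / \<eta> * h x > 0"
    proof (cases "h x \<ge> \<eta>")
      case True
      then have "(B + 1) / \<eta> * h x \<ge> (B + 1) / \<eta> * \<eta>"
        using B(1) \<eta>(1) by (intro mult_left_mono) auto
      then show ?thesis using B(2)[OF x] \<eta>(1) by simp
    next
      case False
      then have "f x > 0" using \<eta>(1) \<eta>(2)[OF x] by (auto simp: le_max_iff_disj)
      moreover have "(B + 1) / \<eta> * h x \<ge> 0"
        using B(1) \<eta>(1) nonneg[OF x] by simp
      ultimately show ?thesis by simp
    qed
  qed
qed

lemma mult_one_minus_power_le:
  fixes t :: real
  assumes "0 \<le> t" "t \<le> 1" "n > 0"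
  shows "t * (1 - t) ^ n \<le> 1 / real n"
proof -
  have "(1 + real n * t) * (1 - t) ^ n \<le> (1 + t) ^ n * (1 - t) ^ n"
    using assms Bernoulli_inequality[of t n] by (intro mult_right_mono) auto
  also have "\<dots> = (1 - t\<^sup>2) ^ n"
    by (simp add: power2_eq_square algebra_simps flip: power_mult_distrib)
  also have "\<dots> \<le> 1"
    using assms by (intro power_le_one) (auto simp: power_le_one)
  finally have "real n * (t * (1 - t) ^ n) \<le> 1"
    using assms by (simp add: algebra_simps) (smt (verit) zero_le_power)
  then show ?thesis using assms(3) by (simp add: field_simps)
qed

text \<open>The weight \<open>(1 - u / U)\<^sup>n\<close> damps positive values of \<open>u\<close> to order \<open>1 / n\<close> and amplifies negative ones to order
  at least \<open>n\<close>.\<close>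

lemma power_weight_bound:
  fixes u U :: real
  assumes "u \<le> U" "U > 0" "n > 0"
  shows "u * (1 - u / U) ^ n \<le> U / real n - real n * ((max 0 (- u))\<^sup>2 / U)"
proof (cases "u \<ge> 0")
  case True
  have "u / U * (1 - u / U) ^ n \<le> 1 / real n"
    using True assms by (intro mult_one_minus_power_le) auto
  with True assms show ?thesis by (simp add: field_simps)
next
  case False
  have "1 + real n * (- u / U) \<le> (1 + (- u / U)) ^ n"
    using False assms by (intro Bernoulli_inequality) (auto simp: field_simps)
  then have "u * (1 - u / U) ^ n \<le> u * (1 + real n * (- u / U))"
    using False by (intro mult_left_mono_neg) auto
  also have "\<dots> = u - real n * (u\<^sup>2 / U)"
    by (simp add: algebra_simps power2_eq_square)
  also have "\<dots> \<le> U / real n - real n * (u\<^sup>2 / U)"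
    using False assms by (smt (verit) divide_nonneg_nonneg of_nat_0_le_iff)
  finally show ?thesis using False by simp
qed

text \<open>By the preceding bound, subtracting the weighted constraints is at least as good as adding
  \<open>2 N\<close> times the penalty \<open>\<Sum>\<^sub>j max(0, -g\<^sub>j)\<^sup>2 / U\<^sub>j\<close>, up to an error that vanishes as \<open>N\<close> grows.\<close>

lemma absorb_constraints:
  fixes f :: "'a::topological_space \<Rightarrow> real" and g :: "'j \<Rightarrow> 'a \<Rightarrow> real"
  assumes S: "compact S" "continuous_on S f" "\<And>j. j \<in> J \<Longrightarrow> continuous_on S (g j)"
    and U: "\<And>j. j \<in> J \<Longrightarrow> U j > 0" "\<And>j x. j \<in> J \<Longrightarrow> x \<in> S \<Longrightarrow> g j x \<le> U j"
    and J: "finite J"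
    and pos: "\<And>x. x \<in> S \<Longrightarrow> \<forall>j\<in>J. g j x \<ge> 0 \<Longrightarrow> f x > 0"
  shows "\<exists>N. \<forall>x\<in>S. f x - (\<Sum>j\<in>J. g j x * (1 - g j x / U j) ^ (2 * N)) > 0"
proof -
  define h where "h x = (\<Sum>j\<in>J. (max 0 (- g j x))\<^sup>2 / U j)" for x
  have h_cont: "continuous_on S h"
    unfolding h_def using S(3) U(1)
    by (intro continuous_on_sum continuous_on_divide continuous_on_power continuous_on_max
        continuous_on_minus continuous_on_const) force+
  have h_nonneg: "h x \<ge> 0" for x
    unfolding h_def using U(1) by (intro sum_nonneg) (force intro: divide_nonneg_pos)
  have h_zero: "\<forall>j\<in>J. g j x \<ge> 0" if "h x = 0" for x
  proof -
    have "\<forall>j\<in>J. (max 0 (- g j x))\<^sup>2 / U j = 0"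
      using that J U(1) unfolding h_def
      by (subst (asm) sum_nonneg_eq_0_iff) (force intro: divide_nonneg_pos)+
    then show ?thesis using U(1) by (force simp: max_def split: if_splits)
  qed
  obtain \<kappa> where \<kappa>: "\<kappa> \<ge> 0" "\<And>x. x \<in> S \<Longrightarrow> f x + \<kappa> * h x > 0"
    using compact_penalty[OF S(1,2) h_cont] h_nonneg h_zero pos by metis
  have "continuous_on S (\<lambda>x. f x + \<kappa> * h x)"
    by (intro continuous_intros S(2) h_cont)
  from compact_positive_bounded_below[OF S(1) this \<kappa>(2)] obtain \<mu> where \<mu>: "\<mu> > 0" "\<And>x. x \<in> S \<Longrightarrow> f x + \<kappa> * h x \<ge> \<mu>"
    by blast
  define V where "V = (\<Sum>j\<in>J. U j)"
  have V: "V \<ge> 0" unfolding V_def using U(1) by (intro sum_nonneg) force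
  obtain N where N: "real N > \<kappa> + V / \<mu>"
    using reals_Archimedean2 by blast
  have "V / \<mu> \<ge> 0" using V \<mu>(1) by simp
  then have N_\<kappa>: "real (2 * N) \<ge> \<kappa>" and N_pos: "N > 0" and "real (2 * N) > V / \<mu>"
    using N \<kappa>(1) by auto
  then have N_V: "V / real (2 * N) < \<mu>"
    using \<mu>(1) by (simp add: field_simps)
  have "f x - (\<Sum>j\<in>J. g j x * (1 - g j x / U j) ^ (2 * N)) > 0" if x: "x \<in> S" for x
  proof -
    have "(\<Sum>j\<in>J. g j x * (1 - g j x / U j) ^ (2 * N)) \<le>
        (\<Sum>j\<in>J. U j / real (2 * N) - real (2 * N) * ((max 0 (- g j x))\<^sup>2 / U j))"
      using U x N_pos by (intro sum_mono power_weight_bound) auto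
    also have "\<dots> = V / real (2 * N) - real (2 * N) * h x"
      by (simp only: V_def h_def sum_subtractf sum_divide_distrib sum_distrib_left)
    also have "\<dots> \<le> V / real (2 * N) - \<kappa> * h x"
      using N_\<kappa> h_nonneg[of x] by (intro diff_left_mono mult_right_mono) auto
    finally show ?thesis using \<mu>(2)[OF x] N_V by linarith
  qed
  then show ?thesis by blast
qed

section \<open>Positive polynomials on a ball\<close>

lemma poly_mapping_of_function:
  fixes f :: "'v::finite \<Rightarrow> nat"
  obtains \<gamma> where "Poly_Mapping.lookup \<gamma> = f"
  using lookup_Abs_poly_mapping[of f] by (metis finite_code)

text \<open>Substitution of \<open>\<kappa>\<^sub>v w\<^sub>v\<^sup>m\<close> with \<open>m = m\<^sub>v\<close> for each variable maps monomials to monomials. This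
  brings the result of Polya's theorem back to the variables \<open>y\<close>, \<open>z\<close>, \<open>u\<close>.\<close>

lemma substitute_scaled_powers:
  fixes q :: "'v::finite mpoly" and \<kappa> :: "'v \<Rightarrow> real" and m :: "'v \<Rightarrow> nat"
  assumes q: "q \<in> monomial_cone UNIV" and \<kappa>: "\<And>v. \<kappa> v \<ge> 0"
  shows "\<exists>a\<in>monomial_cone {\<beta>. \<forall>v. m v dvd Poly_Mapping.lookup \<beta> v}.
    \<forall>w. mpeval q (\<chi> v. \<kappa> v * (w $ v) ^ m v) = mpeval a w"
proof -
  have "\<forall>\<beta>. \<exists>\<gamma>. \<forall>v. Poly_Mapping.lookup \<gamma> v = m v * Poly_Mapping.lookup \<beta> v"
  proof
    fix \<beta>
    obtain \<gamma> where "Poly_Mapping.lookup \<gamma> = (\<lambda>v. m v * Poly_Mapping.lookup \<beta> v)"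
      by (rule poly_mapping_of_function)
    then show "\<exists>\<gamma>. \<forall>v. Poly_Mapping.lookup \<gamma> v = m v * Poly_Mapping.lookup \<beta> v"
      by (intro exI[of _ \<gamma>]) simp
  qed
  from choice[OF this] obtain \<phi>
    where \<phi>: "\<forall>\<beta> v. Poly_Mapping.lookup (\<phi> \<beta>) v = m v * Poly_Mapping.lookup \<beta> v"
    by blast
  define c where "c \<beta> = (\<Prod>v\<in>UNIV. \<kappa> v ^ Poly_Mapping.lookup \<beta> v)" for \<beta>
  define a where "a = (\<Sum>\<beta>\<in>Poly_Mapping.keys q.
      Poly_Mapping.single (\<phi> \<beta>) (Poly_Mapping.lookup q \<beta> * c \<beta>))"
  have "a \<in> monomial_cone {\<beta>. \<forall>v. m v dvd Poly_Mapping.lookup \<beta> v}"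
    unfolding a_def c_def
    by (intro monomial_cone_sum monomial_cone_single mult_nonneg_nonneg prod_nonneg ballI
        zero_le_power monomial_cone_lookup_nonneg[OF q] \<kappa>) (simp add: \<phi>)
  moreover have "monom_val (\<chi> v. \<kappa> v * (w $ v) ^ m v) \<beta> = c \<beta> * monom_val w (\<phi> \<beta>)" for w \<beta>
    by (simp add: monom_val_def c_def \<phi> power_mult_distrib prod.distrib flip: power_mult)
  then have "mpeval q (\<chi> v. \<kappa> v * (w $ v) ^ m v) = mpeval a w" for w
    by (simp add: a_def mpeval_sum mpeval_single mpeval_altdef[of q] mult.assoc)
  ultimately show ?thesis by blast
qed

text \<open>A monomial in which the exponent of \<open>v\<^sub>0\<close> is odd becomes even after one factor \<open>v\<^sub>0\<close> is
  taken out.\<close>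

lemma split_parity:
  fixes a :: "'v::finite mpoly"
  assumes a: "a \<in> monomial_cone {\<beta>. \<forall>v. v \<noteq> v\<^sub>0 \<longrightarrow> even (Poly_Mapping.lookup \<beta> v)}"
  obtains a\<^sub>0 a\<^sub>1 where
    "a\<^sub>0 \<in> monomial_cone {\<beta>. \<forall>v. even (Poly_Mapping.lookup \<beta> v)}"
    "a\<^sub>1 \<in> monomial_cone {\<beta>. \<forall>v. even (Poly_Mapping.lookup \<beta> v)}"
    "\<And>w. mpeval a w = mpeval a\<^sub>0 w + mpeval a\<^sub>1 w * w $ v\<^sub>0"
proof -
  let ?e = "Poly_Mapping.single v\<^sub>0 (1::nat)"
  let ?even = "{\<beta> \<in> Poly_Mapping.keys a. even (Poly_Mapping.lookup \<beta> v\<^sub>0)}"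
  let ?odd = "{\<beta> \<in> Poly_Mapping.keys a. odd (Poly_Mapping.lookup \<beta> v\<^sub>0)}"
  let ?a\<^sub>0 = "\<Sum>\<beta>\<in>?even. Poly_Mapping.single \<beta> (Poly_Mapping.lookup a \<beta>)"
  let ?a\<^sub>1 = "\<Sum>\<beta>\<in>?odd. Poly_Mapping.single (\<beta> - ?e) (Poly_Mapping.lookup a \<beta>)"
  have keys: "even (Poly_Mapping.lookup \<beta> v)" if "\<beta> \<in> Poly_Mapping.keys a" "v \<noteq> v\<^sub>0" for \<beta> v
    using monomial_cone_keys[OF a that(1)] that(2) by simp
  have nonneg: "Poly_Mapping.lookup a \<beta> \<ge> 0" for \<beta>
    using a by (rule monomial_cone_lookup_nonneg)
  show thesis
  proof (rule that[of ?a\<^sub>0 ?a\<^sub>1])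
    show "?a\<^sub>0 \<in> monomial_cone {\<beta>. \<forall>v. even (Poly_Mapping.lookup \<beta> v)}"
    proof (intro monomial_cone_sum monomial_cone_single nonneg CollectI allI)
      fix \<beta> v assume "\<beta> \<in> ?even"
      then show "even (Poly_Mapping.lookup \<beta> v)"
        using keys by (cases "v = v\<^sub>0") auto
    qed
    show "?a\<^sub>1 \<in> monomial_cone {\<beta>. \<forall>v. even (Poly_Mapping.lookup \<beta> v)}"
    proof (intro monomial_cone_sum monomial_cone_single nonneg CollectI allI)
      fix \<beta> v assume "\<beta> \<in> ?odd"
      then show "even (Poly_Mapping.lookup (\<beta> - ?e) v)"
        using keys by (cases "v = v\<^sub>0") (auto simp: lookup_minus lookup_single when_def)
    qed
    fix w
    have odd: "monom_val w \<beta> = monom_val w (\<beta> - ?e) * w $ v\<^sub>0" if "\<beta> \<in> ?odd" for \<beta>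
    proof -
      have "Poly_Mapping.lookup \<beta> v\<^sub>0 > 0"
        using that by (auto intro: odd_pos)
      then have "\<beta> - ?e + ?e = \<beta>"
        by (intro poly_mapping_eqI) (auto simp: lookup_add lookup_minus lookup_single when_def)
      then show ?thesis
        using monom_val_add[of w "\<beta> - ?e" ?e] monom_val_variable[of w v\<^sub>0] by simp
    qed
    have "mpeval a w = (\<Sum>\<beta>\<in>?even \<union> ?odd. Poly_Mapping.lookup a \<beta> * monom_val w \<beta>)"
      unfolding mpeval_altdef by (intro sum.cong) auto
    also have "\<dots> = (\<Sum>\<beta>\<in>?even. Poly_Mapping.lookup a \<beta> * monom_val w \<beta>) +
        (\<Sum>\<beta>\<in>?odd. Poly_Mapping.lookup a \<beta> * monom_val w \<beta>)"
      by (intro sum.union_disjoint) auto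
    also have "(\<Sum>\<beta>\<in>?odd. Poly_Mapping.lookup a \<beta> * monom_val w \<beta>) = mpeval ?a\<^sub>1 w * w $ v\<^sub>0"
      unfolding mpeval_sum mpeval_single sum_distrib_right
      by (intro sum.cong) (simp_all only: odd mult.assoc)
    finally show "mpeval a w = mpeval ?a\<^sub>0 w + mpeval ?a\<^sub>1 w * w $ v\<^sub>0"
      by (simp add: mpeval_sum mpeval_single)
  qed
qed

lemma sum_yzu:
  fixes f :: "'n::finite + 'n + unit \<Rightarrow> real"
  shows "(\<Sum>v\<in>UNIV. f v) = (\<Sum>i\<in>UNIV. f (Inl i) + f (Inr (Inl i))) + f (Inr (Inr ()))"
  by (simp add: sum.Plus sum.distrib UNIV_unit flip: UNIV_Plus_UNIV)

lemma norm_squared_eq_sum: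
  fixes x :: "real ^ 'n::finite"
  shows "(norm x)\<^sup>2 = (\<Sum>i\<in>UNIV. (x $ i)\<^sup>2)"
  unfolding power2_norm_eq_inner inner_vec_def by (simp add: power2_eq_square)

text \<open>This identity places the rescaled squares of \<open>r + x\<^sub>i\<close> and \<open>r - x\<^sub>i\<close>, completed by
  \<open>2 (r\<^sup>2 - \<parallel>x\<parallel>\<^sup>2)\<close>, in the hyperplane of the standard simplex.\<close>

lemma sum_squares_plus_minus:
  fixes x :: "real ^ 'n::finite"
  shows "(\<Sum>i\<in>UNIV. (r + x $ i)\<^sup>2 + (r - x $ i)\<^sup>2) = 2 * real CARD('n) * r\<^sup>2 + 2 * (norm x)\<^sup>2"
proof -
  have "(r + x $ i)\<^sup>2 + (r - x $ i)\<^sup>2 = 2 * r\<^sup>2 + 2 * (x $ i)\<^sup>2" for i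
    by (simp add: power2_eq_square algebra_simps)
  then show ?thesis
    by (simp add: sum.distrib norm_squared_eq_sum sum_distrib_left)
qed

text \<open>Let \<open>W\<close> denote the map from \<open>\<real>\<^sup>n\<close> to the hyperplane given by the rescaled functions
  \<open>(r + x\<^sub>i)\<^sup>2\<close>, \<open>(r - x\<^sub>i)\<^sup>2\<close>, \<open>2 (r\<^sup>2 - \<parallel>x\<parallel>\<^sup>2)\<close>. The linear map \<open>X\<close> is a left inverse of \<open>W\<close>, and
  \<open>R\<close> vanishes on the image of \<open>W\<close>. A point \<open>w\<close> of the simplex with \<open>R w = 0\<close> comes from the ball,
  because the value \<open>r\<^sup>2 - \<parallel>X w\<parallel>\<^sup>2\<close> is forced to be a non-negative multiple of the last coordinate.
  So \<open>q \<circ> X + \<kappa> R\<close> is positive on the simplex for some \<open>\<kappa>\<close>, and its composition with \<open>W\<close> is \<open>q\<close>.\<close>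

lemma positive_on_ball_representation:
  fixes q :: "real ^ 'n::finite \<Rightarrow> real"
  assumes q: "real_polynomial_function q" and r: "r > 0"
    and pos: "\<And>x. x \<in> cball 0 r \<Longrightarrow> q x > 0"
  obtains a :: "('n + 'n + unit) mpoly" where
    "a \<in> monomial_cone {\<beta>. \<forall>v. v \<noteq> Inr (Inr ()) \<longrightarrow> even (Poly_Mapping.lookup \<beta> v)}"
    "\<And>x. q x = mpeval a (join_yzu (x + r *\<^sub>R ones) (r *\<^sub>R ones - x) (r\<^sup>2 - (norm x)\<^sup>2))"
proof -
  define L where "L = 2 * (real CARD('n) + 1) * r\<^sup>2"
  have L: "L > 0" unfolding L_def using r by simp
  define X :: "real ^ ('n + 'n + unit) \<Rightarrow> real ^ 'n" where
    "X w = (\<chi> i. L * (w $ Inl i - w $ Inr (Inl i)) / (4 * r))" for w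
  define R where "R w = (\<Sum>i\<in>UNIV. (L * w $ Inl i - (r + X w $ i)\<^sup>2)\<^sup>2)" for w
  have lin: "real_polynomial_function (\<lambda>w. w $ v)" for v :: "'n + 'n + unit"
    by (intro real_polynomial_function.intros bounded_linear_vec_nth)
  have X_poly: "real_polynomial_function (\<lambda>w. X w $ i)" for i
    unfolding X_def vec_lambda_beta
    by (intro real_polynomial_function_divide real_polynomial_function_diff lin
        real_polynomial_function.intros(2,4))
  have "bounded_linear X"
    unfolding X_def linear_conv_bounded_linear[symmetric]
    by (rule linearI)
      (simp_all add: vec_eq_iff add_divide_distrib diff_divide_distrib algebra_simps)
  then have qX_poly: "real_polynomial_function (\<lambda>w. q (X w))"
    using real_polynomial_function_compose[OF polynomial_function_bounded_linear q]
    by (simp add: o_def)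
  have R_poly: "real_polynomial_function R"
    unfolding R_def
    by (intro real_polynomial_function_sum real_polynomial_function_power
        real_polynomial_function_diff real_polynomial_function.intros(2,3,4) lin X_poly) auto
  \<comment> \<open>On the zero set of \<open>R\<close> in the simplex the first two groups of coordinates are the
    squares of \<open>r + x\<^sub>i\<close> and \<open>r - x\<^sub>i\<close>; since all coordinates sum to 1, the last one fixes the norm of \<open>x\<close>.\<close>
  have pos_zero: "q (X w) > 0" if w: "w \<in> standard_simplex" and "R w = 0" for w
  proof (rule pos)
    have y: "L * w $ Inl i = (r + X w $ i)\<^sup>2" for i
      using \<open>R w = 0\<close> unfolding R_def by (subst (asm) sum_nonneg_eq_0_iff) auto
    have z: "L * w $ Inr (Inl i) = (r - X w $ i)\<^sup>2" for i
    proof -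
      have "4 * r * X w $ i = L * (w $ Inl i - w $ Inr (Inl i))"
        using r by (simp add: X_def)
      then show ?thesis
        using y[of i] by (simp add: power2_eq_square algebra_simps)
    qed
    have "L = L * (\<Sum>v\<in>UNIV. w $ v)"
      using w by (simp add: standard_simplex_def)
    also have "\<dots> = (\<Sum>i\<in>UNIV. L * w $ Inl i + L * w $ Inr (Inl i)) + L * w $ Inr (Inr ())"
      by (simp only: sum_yzu sum_distrib_left distrib_left)
    also have "\<dots> = 2 * real CARD('n) * r\<^sup>2 + 2 * (norm (X w))\<^sup>2 + L * w $ Inr (Inr ())"
      by (simp only: y z sum_squares_plus_minus)
    finally have "L = 2 * real CARD('n) * r\<^sup>2 + 2 * (norm (X w))\<^sup>2 + L * w $ Inr (Inr ())" .
    moreover have "L = 2 * real CARD('n) * r\<^sup>2 + 2 * r\<^sup>2"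
      by (simp add: L_def algebra_simps)
    moreover have "L * w $ Inr (Inr ()) \<ge> 0"
      using L w by (simp add: standard_simplex_def)
    ultimately have "(norm (X w))\<^sup>2 \<le> r\<^sup>2" by linarith
    then show "X w \<in> cball 0 r"
      using r by (simp add: power2_le_iff_abs_le)
  qed
  have cont: "continuous_on standard_simplex f" if "real_polynomial_function f"
    for f :: "real ^ ('n + 'n + unit) \<Rightarrow> real"
    using that by (intro continuous_on_polymonial_function) (simp add: real_polynomial_function_eq)
  have R_nonneg: "R w \<ge> 0" for w
    unfolding R_def by (intro sum_nonneg) simp
  obtain \<kappa> where \<kappa>: "\<And>w. w \<in> standard_simplex \<Longrightarrow> q (X w) + \<kappa> * R w > 0"
    using compact_penalty[OF compact_standard_simplex cont[OF qX_poly] cont[OF R_poly] R_nonneg pos_zero]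
    by blast
  have "real_polynomial_function (\<lambda>w. q (X w) + \<kappa> * R w)"
    by (intro real_polynomial_function.intros(2,3,4) qX_poly R_poly)
  from real_polynomial_function_imp_mpeval[OF this] obtain Q
    where Q: "(\<lambda>w. q (X w) + \<kappa> * R w) = mpeval Q" by blast
  have "mpeval Q w > 0" if "w \<in> standard_simplex" for w
    using \<kappa>[OF that] fun_cong[OF Q, of w] by simp
  from polya[OF this] obtain Q' where Q': "Q' \<in> monomial_cone UNIV"
      "\<And>w. (\<Sum>v\<in>UNIV. w $ v) = 1 \<Longrightarrow> mpeval Q w = mpeval Q' w"
    by blast
  \<comment> \<open>The map \<open>W\<close> in terms of \<open>(y, z, u)\<close>: \<open>y\<close> and \<open>z\<close> enter squared, \<open>u\<close> linearly.\<close>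
  define c :: "'n + 'n + unit \<Rightarrow> real" where
    "c v = (case v of Inr (Inr _) \<Rightarrow> 2 / L | _ \<Rightarrow> 1 / L)" for v
  define m :: "'n + 'n + unit \<Rightarrow> nat" where
    "m v = (case v of Inr (Inr _) \<Rightarrow> 1 | _ \<Rightarrow> 2)" for v
  have c_nonneg: "c v \<ge> 0" for v
    using L by (auto simp: c_def split: sum.split)
  from substitute_scaled_powers[of Q' c m, OF Q'(1) c_nonneg]
  obtain a where a: "a \<in> monomial_cone {\<beta>. \<forall>v. m v dvd Poly_Mapping.lookup \<beta> v}"
      "\<And>w. mpeval Q' (\<chi> v. c v * (w $ v) ^ m v) = mpeval a w"
    by blast
  have m_two: "m v = 2" if "v \<noteq> Inr (Inr ())" for v
    using that by (auto simp: m_def split: sum.split)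
  have even: "even (Poly_Mapping.lookup \<beta> v)"
    if "\<forall>v. m v dvd Poly_Mapping.lookup \<beta> v" "v \<noteq> Inr (Inr ())" for \<beta> v
    using that(1)[rule_format, of v] m_two[OF that(2)] by simp
  have a_cone:
    "a \<in> monomial_cone {\<beta>. \<forall>v. v \<noteq> Inr (Inr ()) \<longrightarrow> even (Poly_Mapping.lookup \<beta> v)}"
    by (rule monomial_cone_mono[OF a(1)]) (use even in blast)
  have "q x = mpeval a (join_yzu (x + r *\<^sub>R ones) (r *\<^sub>R ones - x) (r\<^sup>2 - (norm x)\<^sup>2))" for x
  proof -
    let ?J = "join_yzu (x + r *\<^sub>R ones) (r *\<^sub>R ones - x) (r\<^sup>2 - (norm x)\<^sup>2)"
    define W where "W = (\<chi> v. c v * (?J $ v) ^ m v)"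
    have W: "L * W $ Inl i = (r + x $ i)\<^sup>2" "L * W $ Inr (Inl i) = (r - x $ i)\<^sup>2"
        "L * W $ Inr (Inr ()) = 2 * (r\<^sup>2 - (norm x)\<^sup>2)" for i
      using L by (simp_all add: W_def c_def m_def join_yzu_def ones_def add.commute)
    have "L * (\<Sum>v\<in>UNIV. W $ v) =
        (\<Sum>i\<in>UNIV. L * W $ Inl i + L * W $ Inr (Inl i)) + L * W $ Inr (Inr ())"
      by (simp only: sum_yzu sum_distrib_left distrib_left)
    also have "\<dots> = L"
      by (simp only: W sum_squares_plus_minus) (simp add: L_def algebra_simps)
    finally have W_sum: "(\<Sum>v\<in>UNIV. W $ v) = 1"
      using L by simp
    have "X W $ i = x $ i" for i
    proof -
      have "X W $ i = ((r + x $ i)\<^sup>2 - (r - x $ i)\<^sup>2) / (4 * r)"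
        by (simp only: X_def vec_lambda_beta right_diff_distrib W)
      also have "\<dots> = x $ i"
        using r by (simp add: power2_eq_square field_simps)
      finally show ?thesis .
    qed
    then have XW: "X W = x" by (simp add: vec_eq_iff)
    then have "R W = 0" by (simp add: R_def W)
    then have "q x = mpeval Q W"
      using fun_cong[OF Q, of W] XW by simp
    also have "\<dots> = mpeval a ?J"
      using Q'(2)[OF W_sum] a(2)[of ?J] by (simp add: W_def)
    finally show ?thesis .
  qed
  with a_cone that show thesis by blast
qed

section \<open>Membership in the four classes\<close>

abbreviation even_exponents :: "('v::finite \<Rightarrow>\<^sub>0 nat) set" where
  "even_exponents \<equiv> {\<beta>. \<forall>v. even (Poly_Mapping.lookup \<beta> v)}"

lemma even_exponent_halve:
  fixes \<beta> :: "'v::finite \<Rightarrow>\<^sub>0 nat"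
  assumes "\<beta> \<in> even_exponents"
  obtains \<gamma> where "\<beta> = \<gamma> + \<gamma>"
proof -
  obtain \<gamma> where \<gamma>: "Poly_Mapping.lookup \<gamma> = (\<lambda>v. Poly_Mapping.lookup \<beta> v div 2)"
    by (rule poly_mapping_of_function)
  have "\<beta> = \<gamma> + \<gamma>"
    using assms by (intro poly_mapping_eqI) (simp add: lookup_add \<gamma> flip: mult_2)
  then show thesis by (rule that)
qed

text \<open>The binomial is degenerate, with two equal terms, so that it complies with the sign condition for DSOS.\<close>

lemma even_single_eq_binomial_square:
  fixes \<beta> :: "'v::finite \<Rightarrow>\<^sub>0 nat"
  assumes "\<beta> \<in> even_exponents" "c \<ge> (0::real)"
  shows "\<exists>a \<gamma>. Poly_Mapping.single \<beta> c = (Poly_Mapping.single \<gamma> a + Poly_Mapping.single \<gamma> a)\<^sup>2"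
proof -
  obtain \<gamma> where "\<beta> = \<gamma> + \<gamma>"
    using even_exponent_halve[OF assms(1)] .
  moreover have "c = (sqrt c / 2 + sqrt c / 2) * (sqrt c / 2 + sqrt c / 2)"
    using assms(2) by simp
  ultimately have "Poly_Mapping.single \<beta> c =
      (Poly_Mapping.single \<gamma> (sqrt c / 2) + Poly_Mapping.single \<gamma> (sqrt c / 2))\<^sup>2"
    by (simp only: power2_eq_square single_add[symmetric] mult_single)
  then show ?thesis by blast
qed

text \<open>The simplex is a single point, which is its own relative interior; the inner term has
  coefficient 0.\<close>

lemma even_single_circuit_polynomial:
  fixes \<beta> :: "'v::finite \<Rightarrow>\<^sub>0 nat"
  assumes "\<beta> \<in> even_exponents" "c > 0"
  shows "circuit_polynomial (Poly_Mapping.single \<beta> c)"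
  unfolding circuit_polynomial_def
  by (rule exI[of _ "{\<beta>}"], rule exI[of _ "\<lambda>_. c"], rule exI[of _ 0], rule exI[of _ \<beta>])
    (use assms in \<open>simp add: rel_interior_sing\<close>)

lemma even_single_nonneg:
  assumes "\<beta> \<in> even_exponents" "c \<ge> 0"
  shows "mpeval (Poly_Mapping.single \<beta> c) w \<ge> 0"
  unfolding mpeval_single monom_val_def
  using assms by (intro mult_nonneg_nonneg prod_nonneg) (auto simp: zero_le_even_power)

lemma nonneg_coeffs_in_SAG:
  assumes "q \<in> monomial_cone E"
  shows "q \<in> SAG"
proof -
  have "AMGM_polynomial q"
    unfolding AMGM_polynomial_def
  proof (intro conjI allI impI)
    fix w :: "real ^ 'a" assume "\<forall>i. w $ i \<ge> 0"
    then show "mpeval q w \<ge> 0"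
      unfolding mpeval_altdef monom_val_def
      by (intro sum_nonneg mult_nonneg_nonneg prod_nonneg monomial_cone_lookup_nonneg[OF assms]) auto
  next
    have "{\<alpha>. Poly_Mapping.lookup q \<alpha> < 0} = {}"
      using monomial_cone_lookup_nonneg[OF assms] by (auto simp: not_less)
    then show "card {\<alpha>. Poly_Mapping.lookup q \<alpha> < 0} \<le> 1" by simp
  qed
  then show ?thesis
    unfolding SAG_def by (auto intro!: exI[of _ 1] exI[of _ "\<lambda>_. q"])
qed

lemma even_nonneg_coeffs_in_members:
  fixes q :: "'v::finite mpoly"
  assumes q: "q \<in> monomial_cone even_exponents"
  shows "q \<in> members K"
proof -
  let ?S = "Poly_Mapping.keys q"
  let ?c = "Poly_Mapping.lookup q"
  obtain h where h: "bij_betw h {..<card ?S} ?S"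
    using ex_bij_betw_nat_finite[OF finite_keys] atLeast0LessThan by metis
  have hS: "h l \<in> ?S" if "l < card ?S" for l
    using bij_betwE[OF h] that by simp
  have q_sum: "q = (\<Sum>l<card ?S. Poly_Mapping.single (h l) (?c (h l)))"
    by (subst mpoly_eq_sum_singles) (rule sum.reindex_bij_betw[OF h, symmetric])
  have even: "h l \<in> even_exponents" if "l < card ?S" for l
    using monomial_cone_keys[OF q hS[OF that]] .
  have nonneg: "?c \<beta> \<ge> 0" for \<beta>
    using q by (rule monomial_cone_lookup_nonneg)
  have pos: "?c (h l) > 0" if "l < card ?S" for l
    using nonneg[of "h l"] hS[OF that] by (simp add: in_keys_iff less_le)
  have "\<exists>b. Poly_Mapping.single (h l) (?c (h l)) =
      (Poly_Mapping.single (snd b) (fst b) + Poly_Mapping.single (snd b) (fst b))\<^sup>2"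
    if "l \<in> {..<card ?S}" for l
    using even_single_eq_binomial_square[OF even nonneg, of l] that by auto
  then have "\<forall>l\<in>{..<card ?S}. \<exists>b. Poly_Mapping.single (h l) (?c (h l)) =
      (Poly_Mapping.single (snd b) (fst b) + Poly_Mapping.single (snd b) (fst b))\<^sup>2" ..
  from bchoice[OF this] obtain b where b: "\<forall>l\<in>{..<card ?S}.
      Poly_Mapping.single (h l) (?c (h l)) =
        (Poly_Mapping.single (snd (b l)) (fst (b l)) + Poly_Mapping.single (snd (b l)) (fst (b l)))\<^sup>2"
    by blast
  define a where "a l = fst (b l)" for l
  define \<gamma> where "\<gamma> l = snd (b l)" for l
  have q_sq: "q = (\<Sum>l<card ?S. (Poly_Mapping.single (\<gamma> l) (a l) + Poly_Mapping.single (\<gamma> l) (a l))\<^sup>2)"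
    unfolding a_def \<gamma>_def by (subst q_sum) (use b in \<open>intro sum.cong refl, blast\<close>)
  show ?thesis
  proof (cases K)
    case SONC_class
    have "circuit_polynomial (Poly_Mapping.single (h l) (?c (h l))) \<and>
        (\<forall>w. mpeval (Poly_Mapping.single (h l) (?c (h l))) w \<ge> 0)" if "l < card ?S" for l
      using even_single_circuit_polynomial[OF even pos] even_single_nonneg[OF even nonneg] that
      by blast
    then have "q \<in> SONC"
      unfolding SONC_def
      by (intro CollectI exI[of _ "card ?S"] exI[of _ "\<lambda>l. Poly_Mapping.single (h l) (?c (h l))"]
          conjI allI impI q_sum) blast+
    then show ?thesis by (simp add: SONC_class)
  next
    case SDSOS_class
    have "q \<in> SDSOS"
      unfolding SDSOS_def using q_sq by blast
    then show ?thesis by (simp add: SDSOS_class)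
  next
    case DSOS_class
    have "q \<in> DSOS"
      unfolding DSOS_def using q_sq by blast
    then show ?thesis by (simp add: DSOS_class)
  next
    case SAG_class
    then show ?thesis using nonneg_coeffs_in_SAG[OF q] by simp
  qed
qed

theorem corollary1:
  fixes g :: "nat \<Rightarrow> 'n::finite mpoly" and p :: "'n mpoly"
    and m :: nat and r :: real and U :: "nat \<Rightarrow> real"
  assumes r_pos: "r > 0"
    and U_pos: "\<And>j. j \<in> {1..m} \<Longrightarrow> U j > 0"
    and U_bound: "\<And>j x. j \<in> {1..m} \<Longrightarrow> x \<in> cball 0 r \<Longrightarrow> mpeval (g j) x \<le> U j"
    and p_pos: "\<And>x. x \<in> cball 0 r \<Longrightarrow> (\<forall>j\<in>{1..m}. mpeval (g j) x \<ge> 0) \<Longrightarrow> mpeval p x > 0"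
  shows
    "(\<forall>K :: poly_class.
        \<exists>(\<alpha>\<^sub>0 :: ('n + 'n + unit) mpoly) (\<alpha>\<^sub>1 :: ('n + 'n + unit) mpoly) (\<rho> :: nat \<Rightarrow> unit mpoly).
          \<alpha>\<^sub>0 \<in> members K \<and> \<alpha>\<^sub>1 \<in> members K \<and> (\<forall>j\<in>{1..m}. \<rho> j \<in> members K) \<and>
          (\<forall>x. mpeval p x =
             mpeval \<alpha>\<^sub>0 (join_yzu (x + r *\<^sub>R ones) (r *\<^sub>R ones - x) (r\<^sup>2 - (norm x)\<^sup>2)) +
             mpeval \<alpha>\<^sub>1 (join_yzu (x + r *\<^sub>R ones) (r *\<^sub>R ones - x) (r\<^sup>2 - (norm x)\<^sup>2))
               * (r\<^sup>2 - (norm x)\<^sup>2) +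
             (\<Sum>j=1..m. mpeval (\<rho> j) (single_var (U j - mpeval (g j) x)) * mpeval (g j) x)))
     \<and>
     (\<exists>(\<alpha> :: ('n + 'n + unit) mpoly) (\<rho> :: nat \<Rightarrow> unit mpoly).
        \<alpha> \<in> SAG \<and> (\<forall>j\<in>{1..m}. \<rho> j \<in> SAG) \<and>
        (\<forall>x. mpeval p x =
           mpeval \<alpha> (join_yzu (x + r *\<^sub>R ones) (r *\<^sub>R ones - x) (r\<^sup>2 - (norm x)\<^sup>2)) +
           (\<Sum>j=1..m. mpeval (\<rho> j) (single_var (U j - mpeval (g j) x)) * mpeval (g j) x)))"
proof -
  let ?J = "\<lambda>x :: real ^ 'n. join_yzu (x + r *\<^sub>R ones) (r *\<^sub>R ones - x) (r\<^sup>2 - (norm x)\<^sup>2)"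
  have cont: "continuous_on (cball 0 r) (mpeval q)" for q :: "'n mpoly"
    using real_polynomial_function_mpeval[of q]
    by (intro continuous_on_polymonial_function) (simp add: real_polynomial_function_eq)
  have "\<exists>N. \<forall>x\<in>cball 0 r. mpeval p x -
      (\<Sum>j\<in>{1..m}. mpeval (g j) x * (1 - mpeval (g j) x / U j) ^ (2 * N)) > 0"
    using U_pos U_bound p_pos by (intro absorb_constraints cont) auto
  then obtain N where N: "\<And>x. x \<in> cball 0 r \<Longrightarrow> mpeval p x -
      (\<Sum>j=1..m. mpeval (g j) x * (1 - mpeval (g j) x / U j) ^ (2 * N)) > 0"
    by blast
  define \<rho> :: "nat \<Rightarrow> unit mpoly" where
    "\<rho> j = Poly_Mapping.single (Poly_Mapping.single () (2 * N)) (1 / U j ^ (2 * N))" for j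
  have \<rho>_cone: "\<rho> j \<in> monomial_cone even_exponents" for j
    unfolding \<rho>_def by (intro monomial_cone_single) simp_all
  have \<rho>_val: "mpeval (\<rho> j) (single_var (U j - mpeval (g j) x)) =
      (1 - mpeval (g j) x / U j) ^ (2 * N)" if "j \<in> {1..m}" for j and x :: "real ^ 'n"
    using U_pos[OF that]
    by (simp add: \<rho>_def mpeval_single monom_val_def UNIV_unit single_var_def diff_divide_distrib
        flip: power_divide)
  define q where "q x = mpeval p x -
      (\<Sum>j=1..m. mpeval (\<rho> j) (single_var (U j - mpeval (g j) x)) * mpeval (g j) x)" for x
  have q_eq: "q x = mpeval p x -
      (\<Sum>j=1..m. mpeval (g j) x * (1 - mpeval (g j) x / U j) ^ (2 * N))" for x
    unfolding q_def by (simp add: \<rho>_val mult.commute)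
  have q_poly: "real_polynomial_function q"
    unfolding q_eq[abs_def]
    by (intro real_polynomial_function_diff real_polynomial_function_sum
        real_polynomial_function.intros(2,4) real_polynomial_function_power
        real_polynomial_function_divide real_polynomial_function_mpeval finite_atLeastAtMost)
  have q_pos: "q x > 0" if "x \<in> cball 0 r" for x
    using N[OF that] by (simp only: q_eq)
  from positive_on_ball_representation[OF q_poly r_pos q_pos]
  obtain a :: "('n + 'n + unit) mpoly" where
    a: "a \<in> monomial_cone {\<beta>. \<forall>v. v \<noteq> Inr (Inr ()) \<longrightarrow> even (Poly_Mapping.lookup \<beta> v)}"
      "\<And>x. q x = mpeval a (?J x)"
    by blast
  from split_parity[OF a(1)] obtain a\<^sub>0 a\<^sub>1 where a01: "a\<^sub>0 \<in> monomial_cone even_exponents" "a\<^sub>1 \<in> monomial_cone even_exponents"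
      "\<And>w. mpeval a w = mpeval a\<^sub>0 w + mpeval a\<^sub>1 w * w $ Inr (Inr ())"
    by blast
  have J_u: "?J x $ Inr (Inr ()) = r\<^sup>2 - (norm x)\<^sup>2" for x
    by (simp add: join_yzu_def)
  have p_eq: "mpeval p x = mpeval a (?J x) +
      (\<Sum>j=1..m. mpeval (\<rho> j) (single_var (U j - mpeval (g j) x)) * mpeval (g j) x)" for x
    using a(2)[of x] by (simp add: q_def)
  have p_eq01: "mpeval p x = mpeval a\<^sub>0 (?J x) + mpeval a\<^sub>1 (?J x) * (r\<^sup>2 - (norm x)\<^sup>2) +
      (\<Sum>j=1..m. mpeval (\<rho> j) (single_var (U j - mpeval (g j) x)) * mpeval (g j) x)" for x
    using p_eq[of x] a01(3)[of "?J x"] by (simp only: J_u)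
  show ?thesis
  proof (rule conjI, goal_cases)
    case 1
    show ?case
      by (intro allI exI[of _ a\<^sub>0] exI[of _ a\<^sub>1] exI[of _ \<rho>] conjI ballI
          even_nonneg_coeffs_in_members a01(1,2) \<rho>_cone p_eq01)
  next
    case 2
    show ?case
      by (intro exI[of _ a] exI[of _ \<rho>] conjI ballI allI nonneg_coeffs_in_SAG[OF a(1)]
          nonneg_coeffs_in_SAG[OF \<rho>_cone] p_eq)
  qed
qed

end
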